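(* Let $X$ be a normed space and $C\subset X$ a pointed cone. The following are equivalent: (i) $0_X$ is a denting point of $C$. (ii) There exist $n\in\mathbb{N}$, $\{f_i\}_{i=1}^n\subset C^{*}$, and $\{\lambda_i\}_{i=1}^n\subset(0,+\infty)$ such that the set $\bigcap_{i=1}^n\{x\in X: f_i(x)<\lambda_i\}\cap C$ is bounded. (iii) $0_X$ is a point of continuity for $C$ and $\overline{C^*-C^*}=X^*$ (norm closure in $X^*$). (iv) $C^*$ has an order unit. (v) There exists a sequence $\{f_n\}_{n\geq 1}\subset C^*$ such that $X^*=\bigcup_{n\geq 1}[-nf_n,nf_n]$.
   Context: Normed spaces are real and not assumed complete; $X^*$ is the topological dual with the dual norm; $0_X$ is the origin of $X$; "weak" denotes the weak topology of $X$. A cone is a nonempty convex subset $C\subset X$ with $\alpha C\subset C$ for all real $\alpha\ge 0$ (not assumed closed). It is pointed if $C\cap(-C)=\{0_X\}$. The dual cone is $C^*=\{f\in X^*: f(c)\ge 0\ \forall c\in C\}$, a cone in $X^*$. For a convex set $A\subset X$, a point $x\in A$ is a denting point of $A$ if for every $\epsilon>0$, $x\notin\overline{\mathrm{conv}}(A\setminus B_\epsilon(x))$, where $B_\epsilon(x)$ is the open ball with centre $x$ and radius $\epsilon$ and $\overline{\mathrm{conv}}$ is the closed convex hull. A point $x\in A$ is a point of continuity for $A$ if the identity map $(A,\text{weak})\to(A,\|\cdot\|)$ is continuous at $x$. Given a cone $K$ in a normed space $Y$, the order given by $K$ is $x\le y\Leftrightarrow y-x\in K$, and $[x,y]=\{z\in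 Y: x\le z\le y\}$. An element $k\in K$ is an order unit of $K$ if $Y=\bigcup_{n\ge1}[-nk,nk]$. In (iv) and (v) these notions are used with $Y=X^*$ and $K=C^*$. *)

theory Defs
  imports "HOL-Analysis.Analysis"
begin

text \<open>
  Cones are the library's \<^const>\<open>convex_cone\<close> sets (nonempty, convex, closed under multiplication
  by nonnegative reals; not necessarily topologically closed).  The topological dual of \<open>'a\<close> is
  the type \<open>'a \<Rightarrow>\<^sub>L real\<close>, whose norm is the operator norm.
\<close>

definition pointed :: "'a::real_vector set \<Rightarrow> bool"
  where "pointed C \<longleftrightarrow> C \<inter> uminus ` C = {0}"

definition dual_cone :: "'a::real_normed_vector set \<Rightarrow> ('a \<Rightarrow>\<^sub>L real) set"
  where "dual_cone C = {f. \<forall>c\<in>C. 0 \<le> blinfun_apply f c}"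

lemma convex_cone_dual_cone: "convex_cone (dual_cone C)"
  by (auto simp: Convex.convex_cone_def convex_def conic_def dual_cone_def blinfun.add_left blinfun.scaleR_left intro: exI[of _ 0])

definition denting_point :: "'a::real_normed_vector set \<Rightarrow> 'a \<Rightarrow> bool"
  where "denting_point A x \<longleftrightarrow>
    x \<in> A \<and> (\<forall>\<epsilon>>0. x \<notin> closure (convex hull (A - ball x \<epsilon>)))"

definition weak_topology :: "'a::real_normed_vector topology"
  where "weak_topology =
    topology_generated_by {blinfun_apply f -` U |(f :: 'a \<Rightarrow>\<^sub>L real) U. open U}"

lemma topspace_weak_topology: "topspace (weak_topology :: 'a::real_normed_vector topology) = UNIV"
proof -
  have "blinfun_apply (0 :: 'a \<Rightarrow>\<^sub>L real) -` UNIV \<in>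
      {blinfun_apply f -` U |(f :: 'a \<Rightarrow>\<^sub>L real) U. open U}"
    by blast
  then show ?thesis
    unfolding weak_topology_def topology_generated_by_topspace by blast
qed

definition point_of_continuity :: "'a::real_normed_vector set \<Rightarrow> 'a \<Rightarrow> bool"
  where "point_of_continuity A x \<longleftrightarrow>
    x \<in> A \<and> topcontinuous_at (subtopology weak_topology A) (top_of_set A) (\<lambda>y. y) x"

definition cone_le :: "'b::real_normed_vector set \<Rightarrow> 'b \<Rightarrow> 'b \<Rightarrow> bool"
  where "cone_le K x y \<longleftrightarrow> y - x \<in> K"

definition cone_interval :: "'b::real_normed_vector set \<Rightarrow> 'b \<Rightarrow> 'b \<Rightarrow> 'b set"
  where "cone_interval K x y = {z. cone_le K x z \<and> cone_le K z y}"

definition order_unit :: "'b::real_normed_vector set \<Rightarrow> 'b \<Rightarrow> bool"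
  where "order_unit K k \<longleftrightarrow>
    k \<in> K \<and> (\<Union>n\<in>{1::nat..}. cone_interval K (- (real n *\<^sub>R k)) (real n *\<^sub>R k)) = UNIV"

end

theory Submission
  imports Defs
begin

text \<open>
  All five conditions are reformulations of one: some continuous functional \<open>f\<close> dominates the norm
  on the cone, \<open>\<delta> * norm c \<le> f c\<close> for all \<open>c \<in> C\<close> with a fixed \<open>\<delta> > 0\<close>. Such an \<open>f\<close> is called
  coercive on \<open>C\<close>; it lies in the dual cone, and by homogeneity it suffices to bound it below by
  a positive constant on the unit sphere of \<open>C\<close> (\<open>coercive_on_if_sphere\<close>).

  A coercive \<open>f\<close> gives everything directly. The closed half-spaces \<open>\<delta> * \<epsilon> \<le> f x\<close> contain
  \<open>C - ball 0 \<epsilon>\<close> but not \<open>0\<close>, so \<open>0\<close> is denting; the slices \<open>f x < t\<close> of \<open>C\<close> are bounded, and they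
  are weak neighbourhoods of \<open>0\<close> in \<open>C\<close> whose diameters shrink with \<open>t\<close>; and \<open>\<bar>g c\<bar> \<le> (norm g / \<delta>) * f c\<close>
  for every \<open>g\<close>, so \<open>f\<close> is an order unit and the dual cone spans the dual space.

  Conversely, each condition produces a coercive functional.
  \<^item> From denting: the Hahn--Banach theorem separates \<open>0\<close> from the convex hull of \<open>C - ball 0 1\<close>, which
    contains the unit sphere of \<open>C\<close>.
  \<^item> From a bounded slice: the sum of the functionals that cut it out. On a large multiple of a unit
    vector of \<open>C\<close> one of them, hence the sum, must reach its bound.
  \<^item> From continuity and density: a weak neighbourhood of \<open>0\<close> within which \<open>C\<close> has norm below \<open>1\<close> is
    controlled by finitely many functionals; each is close in norm to a difference \<open>p - q\<close> of elements
    of the dual cone, and the sum of all these \<open>p + q\<close> is coercive.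
  \<^item> From a countable cover of the dual by order intervals \<open>[-h, h]\<close>, in particular from an order unit:
    these are closed and the dual is complete, so by the Baire category theorem one of them contains a
    ball. Then \<open>h\<close> dominates, up to a constant, every functional of norm at most \<open>1\<close> on \<open>C\<close>, hence also
    the norm, because norming functionals exist.

  Both uses of Hahn--Banach are instances of \<open>norming_functional_convex\<close>, which is obtained from the
  fact that a minimal sublinear functional is linear.
\<close>

section \<open>Sublinear functionals and the Hahn--Banach theorem\<close>

definition sublinear :: "('a::real_vector \<Rightarrow> real) \<Rightarrow> bool"
  where "sublinear p \<longleftrightarrow>
    (\<forall>x y. p (x + y) \<le> p x + p y) \<and> (\<forall>t x. 0 \<le> t \<longrightarrow> p (t *\<^sub>R x) = t * p x)"

lemma sublinear_add: "sublinear p \<Longrightarrow> p (x + y) \<le> p x + p y"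
  by (simp add: sublinear_def)

lemma sublinear_scale: "sublinear p \<Longrightarrow> 0 \<le> t \<Longrightarrow> p (t *\<^sub>R x) = t * p x"
  by (simp add: sublinear_def)

lemma sublinear_zero: "sublinear p \<Longrightarrow> p 0 = 0"
  using sublinear_scale[of p 0 0] by simp

lemma sublinear_minus: "sublinear p \<Longrightarrow> - p (- x) \<le> p x"
  using sublinear_add[of p x "- x"] sublinear_zero[of p] by simp

lemma sublinear_norm: "sublinear (norm :: 'a::real_normed_vector \<Rightarrow> real)"
  by (simp add: sublinear_def norm_triangle_ineq)

text \<open>
  Replacing \<open>t\<close> by \<open>1/t\<close> turns the inequality for scaling into an equality; at \<open>t = 0\<close>, the
  factors \<open>2\<close> and \<open>1/2\<close> force \<open>p 0\<close> to vanish.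
\<close>

lemma sublinearI:
  assumes add: "\<And>x y. p (x + y) \<le> p x + p y"
    and scale: "\<And>t x. 0 < t \<Longrightarrow> p (t *\<^sub>R x) \<le> t * p x"
  shows "sublinear p"
proof -
  have "p (t *\<^sub>R x) = t * p x" if "0 \<le> t" for t x
  proof (cases "t = 0")
    case True
    then show ?thesis
      using scale[of 2 0] scale[of "1/2" 0] by simp
  next
    case False
    then have "0 < t"
      using that by simp
    then have "p x \<le> p (t *\<^sub>R x) / t"
      using scale[of "1/t" "t *\<^sub>R x"] by simp
    then show ?thesis
      using scale[OF \<open>0 < t\<close>, of x] \<open>0 < t\<close> by (simp add: field_simps)
  qed
  then show ?thesis
    using add by (simp add: sublinear_def)
qed

text \<open>
  Common core of the two constructions of smaller sublinear functionals below: the shift along a convex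
  set and the infimum of a chain.
\<close>

lemma sublinear_Inf:
  fixes S :: "'a::real_vector \<Rightarrow> real set"
  assumes ne: "\<And>x. S x \<noteq> {}" and bdd: "\<And>x. bdd_below (S x)"
    and add: "\<And>x y a b. a \<in> S x \<Longrightarrow> b \<in> S y \<Longrightarrow> \<exists>c\<in>S (x + y). c \<le> a + b"
    and scale: "\<And>t x a. 0 < t \<Longrightarrow> a \<in> S x \<Longrightarrow> \<exists>c\<in>S (t *\<^sub>R x). c \<le> t * a"
  shows "sublinear (\<lambda>x. Inf (S x))"
proof (rule sublinearI)
  fix x y
  have *: "Inf (S (x + y)) \<le> a + b" if "a \<in> S x" "b \<in> S y" for a b
    using add[OF that] cInf_lower[OF _ bdd] by (meson order_trans)
  have "Inf (S (x + y)) - Inf (S x) \<le> b" if "b \<in> S y" for b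
  proof -
    have "Inf (S (x + y)) - b \<le> Inf (S x)"
      using *[OF _ that] by (intro cInf_greatest ne) (simp add: algebra_simps)
    then show ?thesis by simp
  qed
  then have "Inf (S (x + y)) - Inf (S x) \<le> Inf (S y)"
    by (intro cInf_greatest ne)
  then show "Inf (S (x + y)) \<le> Inf (S x) + Inf (S y)" by simp
next
  fix t :: real and x assume t: "0 < t"
  have "Inf (S (t *\<^sub>R x)) / t \<le> a" if "a \<in> S x" for a
  proof -
    have "Inf (S (t *\<^sub>R x)) \<le> t * a"
      using scale[OF t that] cInf_lower[OF _ bdd] by (meson order_trans)
    then show ?thesis using t by (simp add: field_simps)
  qed
  then have "Inf (S (t *\<^sub>R x)) / t \<le> Inf (S x)"
    by (intro cInf_greatest ne)
  then show "Inf (S (t *\<^sub>R x)) \<le> t * Inf (S x)"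
    using t by (simp add: field_simps)
qed

text \<open>
  The functional \<open>q x = inf (p (x + t *\<^sub>R k) - t * b)\<close>, over \<open>t \<ge> 0\<close> and \<open>k \<in> K\<close>, is the largest
  sublinear functional below \<open>p\<close> with \<open>q (- k) \<le> - b\<close> on \<open>K\<close>; the hypothesis \<open>b \<le> p k\<close> keeps the infimum
  finite. A linear functional below \<open>q\<close> is then at least \<open>b\<close> on \<open>K\<close>, so that separation
  results follow from the mere existence of linear minorants.
\<close>

lemma sublinear_shift:
  fixes p :: "'a::real_vector \<Rightarrow> real"
  assumes p: "sublinear p" and "convex K" "K \<noteq> {}" and b: "\<And>k. k \<in> K \<Longrightarrow> b \<le> p k"
  obtains q where "sublinear q" "\<And>x. q x \<le> p x" "\<And>k. k \<in> K \<Longrightarrow> q (- k) \<le> - b"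
proof -
  define S where "S x = {p (x + t *\<^sub>R k) - t * b | t k. 0 \<le> t \<and> k \<in> K}" for x
  obtain k0 where k0: "k0 \<in> K" using \<open>K \<noteq> {}\<close> by blast
  have S: "p (x + t *\<^sub>R k) - t * b \<in> S x" if "0 \<le> t" "k \<in> K" for x t k
    using that by (auto simp: S_def)
  have low: "- p (- x) \<le> a" if a: "a \<in> S x" for x a
  proof -
    obtain t k where tk: "a = p (x + t *\<^sub>R k) - t * b" "0 \<le> t" "k \<in> K"
      using a by (auto simp: S_def)
    have "t * b \<le> p (t *\<^sub>R k)"
      using tk b by (simp add: sublinear_scale[OF p] mult_left_mono)
    also have "\<dots> \<le> p (x + t *\<^sub>R k) + p (- x)"
      using sublinear_add[OF p, of "x + t *\<^sub>R k" "- x"] by simp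
    finally show ?thesis using tk by simp
  qed
  have bdd: "bdd_below (S x)" for x
    using low by (auto simp: bdd_below_def)
  have "sublinear (\<lambda>x. Inf (S x))"
  proof (rule sublinear_Inf[OF _ bdd])
    show "S x \<noteq> {}" for x
      using S[of 0 k0 x] k0 by auto
  next
    fix x y a a' assume "a \<in> S x" "a' \<in> S y"
    then obtain t k s l where
      a: "a = p (x + t *\<^sub>R k) - t * b" "0 \<le> t" "k \<in> K" and
      a': "a' = p (y + s *\<^sub>R l) - s * b" "0 \<le> s" "l \<in> K"
      unfolding S_def by blast
    \<comment> \<open>Convexity merges the two shifts into one along a single point of \<open>K\<close>.\<close>
    have "\<exists>m\<in>K. t *\<^sub>R k + s *\<^sub>R l = (t + s) *\<^sub>R m"
    proof (cases "t + s = 0")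
      case True
      then have "t = 0" "s = 0" using a a' by auto
      then show ?thesis using k0 by auto
    next
      case False
      then have "(t / (t + s)) *\<^sub>R k + (s / (t + s)) *\<^sub>R l \<in> K"
        using \<open>convex K\<close> a a' by (intro convexD) (auto simp: add_divide_distrib[symmetric])
      moreover have "t *\<^sub>R k + s *\<^sub>R l = (t + s) *\<^sub>R ((t / (t + s)) *\<^sub>R k + (s / (t + s)) *\<^sub>R l)"
        using False by (simp add: scaleR_add_right)
      ultimately show ?thesis by blast
    qed
    then obtain m where m: "m \<in> K" "t *\<^sub>R k + s *\<^sub>R l = (t + s) *\<^sub>R m" by blast
    have "p (x + y + (t + s) *\<^sub>R m) \<le> p (x + t *\<^sub>R k) + p (y + s *\<^sub>R l)"
      using sublinear_add[OF p, of "x + t *\<^sub>R k" "y + s *\<^sub>R l"]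
      unfolding m(2)[symmetric] by (simp add: add_ac)
    then have "p (x + y + (t + s) *\<^sub>R m) - (t + s) * b \<le> a + a'"
      by (simp add: a a' algebra_simps)
    then show "\<exists>c\<in>S (x + y). c \<le> a + a'"
      using S[of "t + s" m "x + y"] m a a' by auto
  next
    fix r :: real and x a assume r: "0 < r" and "a \<in> S x"
    then obtain t k where a: "a = p (x + t *\<^sub>R k) - t * b" "0 \<le> t" "k \<in> K"
      unfolding S_def by blast
    have "p (r *\<^sub>R x + (r * t) *\<^sub>R k) - (r * t) * b = r * a"
      using sublinear_scale[OF p, of r "x + t *\<^sub>R k"] r by (simp add: a algebra_simps)
    then show "\<exists>c\<in>S (r *\<^sub>R x). c \<le> r * a"
      using S[of "r * t" k "r *\<^sub>R x"] a r by auto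
  qed
  moreover have "Inf (S x) \<le> p x" for x
    using cInf_lower[OF S[of 0 k0 x] bdd] k0 by simp
  moreover have "Inf (S (- k)) \<le> - b" if "k \<in> K" for k
    using cInf_lower[OF S[of 1 k "- k"] bdd] that by (simp add: sublinear_zero[OF p])
  ultimately show thesis by (rule that)
qed

text \<open>
  Shifting \<open>q\<close> along a single point \<open>x\<close> with bound \<open>q x\<close> cannot change a minimal functional, which
  therefore already satisfies \<open>q (- x) \<le> - q x\<close>. So it is odd, and an odd sublinear functional is linear.
\<close>

lemma linear_of_minimal_sublinear:
  assumes q: "sublinear q"
    and minimal: "\<And>r. sublinear r \<Longrightarrow> (\<And>x. r x \<le> q x) \<Longrightarrow> r = q"
  shows "linear q"
proof -
  have odd: "q (- x) = - q x" for x
  proof (rule antisym)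
    obtain r where r: "sublinear r" "\<And>y. r y \<le> q y" "\<And>k. k \<in> {x} \<Longrightarrow> r (- k) \<le> - q x"
      by (rule sublinear_shift[OF q, of "{x}" "q x"]) auto
    then have "r = q" by (intro minimal)
    then show "q (- x) \<le> - q x" using r(3)[of x] by simp
    show "- q x \<le> q (- x)" using sublinear_minus[OF q, of x] by simp
  qed
  show ?thesis
  proof (rule linearI)
    fix x y
    have "q (- (x + y)) \<le> q (- x) + q (- y)"
      using sublinear_add[OF q, of "- x" "- y"] by simp
    then show "q (x + y) = q x + q y"
      using sublinear_add[OF q, of x y] odd[of "x + y"] odd[of x] odd[of y] by linarith
  next
    fix t :: real and x
    show "q (t *\<^sub>R x) = t *\<^sub>R q x"
    proof (cases "0 \<le> t")
      case True
      then show ?thesis by (simp add: sublinear_scale[OF q])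
    next
      case False
      then show ?thesis
        using odd[of "(- t) *\<^sub>R x"] sublinear_scale[OF q, of "- t" x] by simp
    qed
  qed
qed

lemma hahn_banach_sublinear:
  fixes p :: "'a::real_vector \<Rightarrow> real"
  assumes p: "sublinear p"
  obtains f where "linear f" "\<And>x. f x \<le> p x"
proof -
  define A where "A = {q. sublinear q \<and> q \<le> p}"
  let ?P = "\<lambda>q r :: 'a \<Rightarrow> real. r \<le> q"
  have "\<exists>m\<in>A. \<forall>a\<in>A. ?P m a \<longrightarrow> a = m"
  proof (rule predicate_Zorn)
    show "partial_order_on A (relation_of ?P A)"
      by (rule partial_order_on_relation_ofI) auto
  next
    fix T assume T: "T \<in> Chains (relation_of ?P A)"
    then have TA: "q \<in> A" if "q \<in> T" for q
      using that by (auto simp: Chains_def relation_of_def)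
    have total: "q \<le> r \<or> r \<le> q" if "q \<in> T" "r \<in> T" for q r
      using T that by (auto simp: Chains_def relation_of_def)
    show "\<exists>u\<in>A. \<forall>a\<in>T. ?P a u"
    proof (cases "T = {}")
      case True
      then show ?thesis using p by (auto simp: A_def)
    next
      case False
      define S where "S x = (\<lambda>q. q x) ` T" for x
      \<comment> \<open>Sublinearity bounds every member of the chain below by the same number \<open>- p (- x)\<close>.\<close>
      have bdd: "bdd_below (S x)" for x
      proof (rule bdd_belowI)
        fix a assume "a \<in> S x"
        then obtain q where q: "q \<in> T" "a = q x" by (auto simp: S_def)
        then have "q (- x) \<le> p (- x)" "- q (- x) \<le> q x"
          using TA[of q] sublinear_minus[of q x] by (auto simp: A_def le_fun_def)
        then show "- p (- x) \<le> a" using q by simp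
      qed
      have "sublinear (\<lambda>x. Inf (S x))"
      proof (rule sublinear_Inf[OF _ bdd])
        show "S x \<noteq> {}" for x using False by (simp add: S_def)
      next
        fix x y a b assume "a \<in> S x" "b \<in> S y"
        then obtain q r where qr: "q \<in> T" "r \<in> T" "a = q x" "b = r y" by (auto simp: S_def)
        define s where "s = (if q \<le> r then q else r)"
        have s: "s \<in> T" "s \<le> q" "s \<le> r"
          using qr total[of q r] by (auto simp: s_def)
        have "s (x + y) \<le> s x + s y"
          using TA[OF s(1)] by (auto simp: A_def sublinear_add)
        also have "\<dots> \<le> a + b"
          using s qr by (auto simp: le_fun_def intro: add_mono)
        finally show "\<exists>c\<in>S (x + y). c \<le> a + b"
          using s(1) by (auto simp: S_def)
      next
        fix t :: real and x a assume "0 < t" "a \<in> S x"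
        then show "\<exists>c\<in>S (t *\<^sub>R x). c \<le> t * a"
          using TA by (fastforce simp: S_def A_def sublinear_scale)
      qed
      moreover have lower: "Inf (S x) \<le> q x" if "q \<in> T" for q x
        using that by (intro cInf_lower bdd) (auto simp: S_def)
      moreover have "(\<lambda>x. Inf (S x)) \<le> p"
        using False lower TA by (fastforce simp: A_def le_fun_def intro: order_trans)
      ultimately show ?thesis
        by (intro bexI[of _ "\<lambda>x. Inf (S x)"]) (auto simp: A_def le_fun_def)
    qed
  qed
  then obtain q where q: "sublinear q" "q \<le> p" and
    min: "\<And>r. sublinear r \<Longrightarrow> r \<le> p \<Longrightarrow> r \<le> q \<Longrightarrow> r = q"
    by (auto simp: A_def)
  have "linear q"
  proof (rule linear_of_minimal_sublinear[OF q(1)])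
    fix r assume "sublinear r" "\<And>x. r x \<le> q x"
    then show "r = q"
      using q(2) by (intro min) (auto simp: le_fun_def intro: order_trans)
  qed
  then show thesis
    using that q(2) by (auto simp: le_fun_def)
qed

text \<open>
  Hahn--Banach in the form needed here: for a singleton \<open>K\<close> and \<open>b\<close> the norm of its element it yields a
  norming functional, and for positive \<open>b\<close> it separates \<open>K\<close> from the origin.
\<close>

lemma norming_functional_convex:
  fixes K :: "'a::real_normed_vector set"
  assumes "convex K" and b: "\<And>k. k \<in> K \<Longrightarrow> b \<le> norm k"
  obtains f :: "'a \<Rightarrow>\<^sub>L real" where "norm f \<le> 1" "\<And>k. k \<in> K \<Longrightarrow> b \<le> blinfun_apply f k"
proof (cases "K = {}")
  case True
  then show thesis using that[of 0] by simp
next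
  case False
  obtain q where q: "sublinear q" "\<And>x. q x \<le> norm x" "\<And>k. k \<in> K \<Longrightarrow> q (- k) \<le> - b"
    using sublinear_shift[OF sublinear_norm \<open>convex K\<close> False b] by blast
  obtain f where f: "linear f" "\<And>x. f x \<le> q x"
    using hahn_banach_sublinear[OF q(1)] by blast
  have abs: "\<bar>f x\<bar> \<le> norm x" for x
    using order_trans[OF f(2) q(2), of x] order_trans[OF f(2) q(2), of "- x"]
    by (simp add: linear_neg[OF f(1)])
  have "bounded_linear f"
    using f(1) abs by (intro bounded_linear_intro[of _ 1]) (auto simp: linear_add linear_scale)
  note apply_f = bounded_linear_Blinfun_apply[OF this]
  show thesis
  proof (rule that)
    show "norm (Blinfun f) \<le> 1"
      using abs by (intro norm_blinfun_bound) (auto simp: apply_f)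
    show "b \<le> blinfun_apply (Blinfun f) k" if "k \<in> K" for k
      using order_trans[OF f(2) q(3)[OF that]] by (simp add: apply_f linear_neg[OF f(1)])
  qed
qed

section \<open>Functionals that dominate the norm on a cone\<close>

text \<open>
  For a convex cone \<open>C\<close> this means that \<open>f\<close> is positive on \<open>C - {0}\<close> and that \<open>{c \<in> C. f c = 1}\<close> is a
  bounded base of \<open>C\<close>.
\<close>

definition coercive_on :: "'a::real_normed_vector set \<Rightarrow> ('a \<Rightarrow>\<^sub>L real) \<Rightarrow> bool"
  where "coercive_on C f \<longleftrightarrow> (\<exists>\<delta>>0. \<forall>c\<in>C. \<delta> * norm c \<le> blinfun_apply f c)"

lemma coercive_onE:
  assumes "coercive_on C f"
  obtains \<delta> where "0 < \<delta>" "\<And>c. c \<in> C \<Longrightarrow> \<delta> * norm c \<le> blinfun_apply f c"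
  using assms by (auto simp: coercive_on_def)

lemma mem_dual_cone_if_coercive:
  assumes "coercive_on C f"
  shows "f \<in> dual_cone C"
proof -
  obtain \<delta> where \<delta>: "0 < \<delta>" "\<And>c. c \<in> C \<Longrightarrow> \<delta> * norm c \<le> blinfun_apply f c"
    using assms by (rule coercive_onE) blast
  have "0 \<le> blinfun_apply f c" if "c \<in> C" for c
    using \<delta>(1) by (intro order_trans[OF _ \<delta>(2)[OF that]]) simp
  then show ?thesis
    by (simp add: dual_cone_def)
qed

lemma coercive_on_if_sphere:
  assumes C: "convex_cone C" and "0 < \<delta>"
    and sphere: "\<And>c. c \<in> C \<Longrightarrow> norm c = 1 \<Longrightarrow> \<delta> \<le> blinfun_apply f c"
  shows "coercive_on C f"
proof -
  have "\<delta> * norm c \<le> blinfun_apply f c" if "c \<in> C" for c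
  proof (cases "c = 0")
    case False
    then have "\<delta> \<le> blinfun_apply f ((1 / norm c) *\<^sub>R c)"
      using that by (intro sphere convex_cone_scaleR[OF C]) auto
    then show ?thesis
      using False by (simp add: blinfun.scaleR_right field_simps)
  qed simp
  then show ?thesis
    using \<open>0 < \<delta>\<close> by (auto simp: coercive_on_def)
qed

lemma denting_point_if_coercive:
  assumes C: "convex_cone C" and f: "coercive_on C f"
  shows "denting_point C 0"
proof -
  obtain \<delta> where \<delta>: "0 < \<delta>" "\<And>c. c \<in> C \<Longrightarrow> \<delta> * norm c \<le> blinfun_apply f c"
    using f by (rule coercive_onE) blast
  have "0 \<notin> closure (convex hull (C - ball 0 \<epsilon>))" if "0 < \<epsilon>" for \<epsilon>
  proof -
    let ?H = "{x. \<delta> * \<epsilon> \<le> blinfun_apply f x}"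
    have "?H = blinfun_apply f -` {\<delta> * \<epsilon>..}" by auto
    then have "convex ?H"
      by (simp add: convex_linear_vimage blinfun.bounded_linear_right bounded_linear.linear)
    have "closed ?H"
      by (intro closed_Collect_le continuous_intros)
    have "C - ball 0 \<epsilon> \<subseteq> ?H"
    proof
      fix c assume "c \<in> C - ball 0 \<epsilon>"
      then have "c \<in> C" "\<epsilon> \<le> norm c" by auto
      then have "\<delta> * \<epsilon> \<le> \<delta> * norm c" using \<delta> by simp
      then show "c \<in> ?H" using \<delta>(2)[OF \<open>c \<in> C\<close>] by simp
    qed
    then have "closure (convex hull (C - ball 0 \<epsilon>)) \<subseteq> ?H"
      using \<open>convex ?H\<close> \<open>closed ?H\<close> by (simp add: closure_minimal hull_minimal)
    moreover have "0 \<notin> ?H"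
      using \<delta> that by (simp add: not_le)
    ultimately show ?thesis by blast
  qed
  then show ?thesis
    using convex_cone_contains_0[OF C] by (auto simp: denting_point_def)
qed

lemma coercive_if_denting_point:
  assumes C: "convex_cone C" and "denting_point C 0"
  shows "\<exists>f. coercive_on C f"
proof -
  \<comment> \<open>The ball is open, so this set contains every unit vector of \<open>C\<close>.\<close>
  let ?K = "convex hull (C - ball 0 1)"
  have "0 \<notin> closure ?K"
    using assms(2) by (simp add: denting_point_def)
  then obtain b where b: "0 < b" "\<And>k. k \<in> ?K \<Longrightarrow> b \<le> norm k"
    by (force simp: closure_approachable dist_norm not_less)
  obtain f :: "'a \<Rightarrow>\<^sub>L real" where f: "\<And>k. k \<in> ?K \<Longrightarrow> b \<le> blinfun_apply f k"
    using norming_functional_convex[OF convex_convex_hull b(2)] by blast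
  have "coercive_on C f"
    by (rule coercive_on_if_sphere[OF C b(1)]) (auto intro!: f hull_inc)
  then show ?thesis ..
qed

text \<open>
  One coercive functional already cuts out a bounded slice. For the converse, homogeneity turns the
  boundedness of the slice into a lower bound on unit vectors.
\<close>

lemma coercive_iff_bounded_slice:
  assumes C: "convex_cone C"
  shows "(\<exists>f. coercive_on C f) \<longleftrightarrow>
    (\<exists>(n::nat) (f :: nat \<Rightarrow> 'a::real_normed_vector \<Rightarrow>\<^sub>L real) (l :: nat \<Rightarrow> real).
       1 \<le> n \<and> (\<forall>i\<in>{1..n}. f i \<in> dual_cone C \<and> 0 < l i) \<and>
       bounded ((\<Inter>i\<in>{1..n}. {x. blinfun_apply (f i) x < l i}) \<inter> C))"
    (is "_ \<longleftrightarrow> ?slice")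
proof
  assume "\<exists>f. coercive_on C f"
  then obtain f where f: "coercive_on C f" ..
  then obtain \<delta> where \<delta>: "0 < \<delta>" "\<And>c. c \<in> C \<Longrightarrow> \<delta> * norm c \<le> blinfun_apply f c"
    by (rule coercive_onE) blast
  have "norm x \<le> 1 / \<delta>" if "blinfun_apply f x < 1" "x \<in> C" for x
    using \<delta>(1) \<delta>(2)[OF that(2)] that(1) by (simp add: field_simps)
  then have "bounded ({x. blinfun_apply f x < 1} \<inter> C)"
    by (auto simp: bounded_iff)
  then show ?slice
    using mem_dual_cone_if_coercive[OF f]
    by (intro exI[of _ 1] exI[of _ "\<lambda>_. f"] exI[of _ "\<lambda>_. 1"]) auto
next
  assume ?slice
  then obtain n and f :: "nat \<Rightarrow> 'a \<Rightarrow>\<^sub>L real" and l :: "nat \<Rightarrow> real" where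
    n: "1 \<le> n" and f: "\<And>i. i \<in> {1..n} \<Longrightarrow> f i \<in> dual_cone C" and
    l: "\<And>i. i \<in> {1..n} \<Longrightarrow> 0 < l i" and
    bdd: "bounded ((\<Inter>i\<in>{1..n}. {x. blinfun_apply (f i) x < l i}) \<inter> C)"
    by blast
  obtain M where M: "0 < M" "\<And>x. x \<in> C \<Longrightarrow> (\<And>i. i \<in> {1..n} \<Longrightarrow> blinfun_apply (f i) x < l i) \<Longrightarrow> norm x \<le> M"
    using bdd unfolding bounded_pos by auto
  define g where "g = (\<Sum>i\<in>{1..n}. f i)"
  define \<mu> where "\<mu> = Min (l ` {1..n})"
  have \<mu>: "0 < \<mu>" "\<And>i. i \<in> {1..n} \<Longrightarrow> \<mu> \<le> l i"
    using n l by (auto simp: \<mu>_def)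
  have le_g: "blinfun_apply (f i) x \<le> blinfun_apply g x" if "i \<in> {1..n}" "x \<in> C" for i x
    using that f unfolding g_def blinfun.sum_left
    by (intro member_le_sum) (auto simp: dual_cone_def)
  have "coercive_on C g"
  proof (rule coercive_on_if_sphere[OF C, of "\<mu> / (2 * M)"])
    show "0 < \<mu> / (2 * M)" using \<mu> M by simp
  next
    fix c assume c: "c \<in> C" "norm c = 1"
    \<comment> \<open>Long enough to leave the slice, which has norm at most \<open>M\<close>.\<close>
    let ?x = "(2 * M) *\<^sub>R c"
    have x: "?x \<in> C" "\<not> norm ?x \<le> M"
      using c M(1) by (auto intro: convex_cone_scaleR[OF C])
    then obtain i where i: "i \<in> {1..n}" "l i \<le> blinfun_apply (f i) ?x"
      using M(2)[of ?x] by (meson not_less)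
    then have "\<mu> \<le> blinfun_apply g ?x"
      using \<mu>(2) le_g[OF i(1) x(1)] by fastforce
    then show "\<mu> / (2 * M) \<le> blinfun_apply g c"
      using M(1) by (simp add: blinfun.scaleR_right field_simps)
  qed
  then show "\<exists>f. coercive_on C f" ..
qed

section \<open>Order units and the Baire category theorem\<close>

text \<open>
  Order intervals of the dual cone are pointwise conditions on \<open>C\<close>; this makes them closed and comparable
  with the norm.
\<close>

lemma mem_cone_interval_dual_cone:
  "g \<in> cone_interval (dual_cone C) (- h) h \<longleftrightarrow>
    (\<forall>c\<in>C. \<bar>blinfun_apply g c\<bar> \<le> blinfun_apply h c)"
  by (auto simp: cone_interval_def cone_le_def dual_cone_def blinfun.diff_left blinfun.add_left
        blinfun.minus_left abs_le_iff)

lemma order_unit_if_coercive: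
  assumes f: "coercive_on C f"
  shows "order_unit (dual_cone C) f"
proof -
  obtain \<delta> where \<delta>: "0 < \<delta>" "\<And>c. c \<in> C \<Longrightarrow> \<delta> * norm c \<le> blinfun_apply f c"
    using f by (rule coercive_onE) blast
  have "\<exists>n\<in>{1::nat..}. g \<in> cone_interval (dual_cone C) (- (real n *\<^sub>R f)) (real n *\<^sub>R f)" for g
  proof -
    obtain m :: nat where m: "norm g / \<delta> \<le> real m"
      using real_arch_simple by blast
    have "\<bar>blinfun_apply g c\<bar> \<le> blinfun_apply (real (Suc m) *\<^sub>R f) c" if "c \<in> C" for c
    proof -
      have "\<bar>blinfun_apply g c\<bar> \<le> norm g * norm c"
        using norm_blinfun[of g c] by simp
      also have "\<dots> \<le> (real (Suc m) * \<delta>) * norm c"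
        using m \<delta>(1) by (intro mult_right_mono) (auto simp: field_simps)
      also have "\<dots> \<le> real (Suc m) * blinfun_apply f c"
        using mult_left_mono[OF \<delta>(2)[OF that], of "real (Suc m)"] by (simp add: mult.assoc)
      finally show ?thesis by (simp add: blinfun.scaleR_left)
    qed
    \<comment> \<open>The intervals are indexed from \<open>1\<close>, whereas \<open>m\<close> may be \<open>0\<close>.\<close>
    then show ?thesis
      by (intro bexI[of _ "Suc m"]) (auto simp: mem_cone_interval_dual_cone)
  qed
  then show ?thesis
    using mem_dual_cone_if_coercive[OF f] by (auto simp: order_unit_def)
qed

lemma closed_cone_interval_dual_cone: "closed (cone_interval (dual_cone C) (- h) h)"
proof -
  have "cone_interval (dual_cone C) (- h) h =
    (\<Inter>c\<in>C. {g. \<bar>blinfun_apply g c\<bar> \<le> blinfun_apply h c})"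
    by (auto simp: mem_cone_interval_dual_cone)
  then show ?thesis
    by (auto intro!: closed_INT closed_Collect_le continuous_intros)
qed

text \<open>
  By Baire's theorem one of the closed intervals has nonempty interior. If \<open>[-h, h]\<close> contains a ball
  of radius \<open>r\<close>, then \<open>2 * h\<close> dominates all functionals of norm less than \<open>r\<close> on \<open>C\<close>, and the
  norming functionals among their multiples recover the norm.
\<close>

lemma coercive_if_countable_cone_interval_cover:
  fixes f :: "nat \<Rightarrow> 'a::real_normed_vector \<Rightarrow>\<^sub>L real"
  assumes C: "convex_cone C"
    and cover: "(\<Union>n\<in>{1..}. cone_interval (dual_cone C) (- (real n *\<^sub>R f n)) (real n *\<^sub>R f n)) = UNIV"
  shows "\<exists>h. coercive_on C h"
proof -
  let ?I = "\<lambda>h. cone_interval (dual_cone C) (- h) h"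
  have "\<exists>n\<in>{1..}. interior (?I (real n *\<^sub>R f n)) \<noteq> {}"
  proof (rule ccontr)
    assume "\<not> ?thesis"
    then have "euclidean interior_of \<Union> ((\<lambda>n. ?I (real n *\<^sub>R f n)) ` {1..}) = {}"
      by (intro Baire_category_alt)
        (auto simp: completely_metrizable_space_euclidean closed_cone_interval_dual_cone)
    then show False using cover by simp
  qed
  then obtain h where "interior (?I h) \<noteq> {}" by blast
  then obtain g r where r: "0 < r" and sub: "ball g r \<subseteq> ?I h"
    by (metis all_not_in_conv mem_interior)
  have "coercive_on C h"
  proof (rule coercive_on_if_sphere[OF C, of "r / 4"])
    show "0 < r / 4" using r by simp
  next
    fix c assume c: "c \<in> C" "norm c = 1"
    obtain u :: "'a \<Rightarrow>\<^sub>L real" where u: "norm u \<le> 1" "\<And>k. k \<in> {c} \<Longrightarrow> 1 \<le> blinfun_apply u k"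
      using c by (elim norming_functional_convex[rotated -1]) auto
    \<comment> \<open>The centre \<open>g\<close> of the ball is arbitrary; a difference of two of its points eliminates it.\<close>
    have "g + (r / 2) *\<^sub>R u \<in> ball g r" "g \<in> ball g r"
      using r u(1) by (auto simp: dist_norm)
    then have "\<bar>blinfun_apply (g + (r / 2) *\<^sub>R u) c\<bar> \<le> blinfun_apply h c"
      "\<bar>blinfun_apply g c\<bar> \<le> blinfun_apply h c"
      using sub c(1) by (auto simp: mem_cone_interval_dual_cone subset_iff)
    then have "(r / 2) * blinfun_apply u c \<le> 2 * blinfun_apply h c"
      by (simp add: blinfun.add_left blinfun.scaleR_left)
    moreover have "r / 2 * 1 \<le> (r / 2) * blinfun_apply u c"
      using u(2)[of c] r by (intro mult_left_mono) auto
    ultimately show "r / 4 \<le> blinfun_apply h c" by simp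
  qed
  then show ?thesis ..
qed

section \<open>Weak neighbourhoods of the origin\<close>

lemma openin_weak_halfspace:
  "openin weak_topology {x. blinfun_apply (f :: 'a::real_normed_vector \<Rightarrow>\<^sub>L real) x < t}"
proof -
  have "{x. blinfun_apply f x < t} = blinfun_apply f -` {..<t}" by auto
  then have "\<exists>(g :: 'a \<Rightarrow>\<^sub>L real) U. {x. blinfun_apply f x < t} = blinfun_apply g -` U \<and> open U"
    using open_lessThan by (intro exI[of _ f] exI[of _ "{..<t}"] conjI)
  then show ?thesis
    unfolding weak_topology_def by (intro topology_generated_by_Basis CollectI)
qed

text \<open>
  Induction over the generation of the open sets: an intersection takes the union of the two finite
  sets of functionals and the smaller radius.
\<close>

lemma weak_neighbourhood_basis:
  assumes "openin weak_topology U" "x \<in> U"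
  shows "\<exists>F e. finite F \<and> 0 < e \<and>
    {y. \<forall>f\<in>F. \<bar>blinfun_apply (f :: 'a::real_normed_vector \<Rightarrow>\<^sub>L real) (y - x)\<bar> < e} \<subseteq> U"
proof -
  have "generate_topology_on {blinfun_apply f -` U |(f :: 'a \<Rightarrow>\<^sub>L real) U. open U} U"
    using assms(1) by (simp add: weak_topology_def openin_topology_generated_by_iff)
  then show ?thesis
    using assms(2)
  proof induction
    case Empty
    then show ?case by simp
  next
    case (Int a b)
    from Int.prems have "x \<in> a" "x \<in> b" by auto
    obtain F :: "('a \<Rightarrow>\<^sub>L real) set" and e where
      "finite F" "0 < e" "{y. \<forall>f\<in>F. \<bar>blinfun_apply f (y - x)\<bar> < e} \<subseteq> a"
      using Int.IH(1)[OF \<open>x \<in> a\<close>] by blast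
    moreover obtain G :: "('a \<Rightarrow>\<^sub>L real) set" and d where
      "finite G" "0 < d" "{y. \<forall>f\<in>G. \<bar>blinfun_apply f (y - x)\<bar> < d} \<subseteq> b"
      using Int.IH(2)[OF \<open>x \<in> b\<close>] by blast
    ultimately show ?case
      by (intro exI[of _ "F \<union> G"] exI[of _ "min e d"]) auto
  next
    case (UN K)
    then obtain k where k: "k \<in> K" "x \<in> k" by blast
    then show ?case using UN.IH[OF k] by blast
  next
    case (Basis s)
    then obtain f :: "'a \<Rightarrow>\<^sub>L real" and V where s: "s = blinfun_apply f -` V" "open V" by blast
    have "blinfun_apply f x \<in> V"
      using Basis.prems s(1) by simp
    then obtain e where e: "0 < e" "ball (blinfun_apply f x) e \<subseteq> V"
      by (rule openE[OF s(2)])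
    have "y \<in> s" if "\<bar>blinfun_apply f (y - x)\<bar> < e" for y
    proof -
      have "blinfun_apply f y \<in> ball (blinfun_apply f x) e"
        using that by (simp only: mem_ball dist_commute[of "blinfun_apply f x"] dist_real_def blinfun.diff_right)
      then show ?thesis using e(2) s(1) by blast
    qed
    then show ?case
      using e(1) by (intro exI[of _ "{f}"] exI[of _ e]) auto
  qed
qed

lemma point_of_continuity_if_coercive:
  assumes C: "convex_cone C" and f: "coercive_on C f"
  shows "point_of_continuity C 0"
proof -
  obtain \<delta> where \<delta>: "0 < \<delta>" "\<And>c. c \<in> C \<Longrightarrow> \<delta> * norm c \<le> blinfun_apply f c"
    using f by (rule coercive_onE) blast
  note zero = convex_cone_contains_0[OF C]
  have "\<exists>U. openin (subtopology weak_topology C) U \<and> 0 \<in> U \<and> (\<forall>y\<in>U. y \<in> V)"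
    if V: "openin (top_of_set C) V" "0 \<in> V" for V
  proof -
    obtain e where e: "0 < e" "ball 0 e \<inter> C \<subseteq> V"
      using V by (auto simp: openin_contains_ball)
    let ?U = "{x. blinfun_apply f x < \<delta> * e} \<inter> C"
    have "?U \<subseteq> V"
    proof
      fix x assume x: "x \<in> ?U"
      then have "\<delta> * norm x < \<delta> * e" using \<delta>(2)[of x] by simp
      then show "x \<in> V" using \<delta>(1) e(2) x by auto
    qed
    then show ?thesis
      using zero \<delta>(1) e(1) openin_weak_halfspace[of f "\<delta> * e"]
      by (intro exI[of _ ?U]) (auto simp: openin_subtopology)
  qed
  then show ?thesis
    using zero by (auto simp: point_of_continuity_def topcontinuous_at_def topspace_weak_topology)
qed

lemma dual_cone_differences_if_coercive:
  assumes f: "coercive_on C f"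
  shows "{f - g |f g. f \<in> dual_cone C \<and> g \<in> dual_cone C} = UNIV"
proof -
  have "\<exists>p q. g = p - q \<and> p \<in> dual_cone C \<and> q \<in> dual_cone C" for g
  proof -
    have "g \<in> (\<Union>n\<in>{1::nat..}. cone_interval (dual_cone C) (- (real n *\<^sub>R f)) (real n *\<^sub>R f))"
      using order_unit_if_coercive[OF f] by (simp add: order_unit_def)
    then obtain n :: nat where n: "g \<in> cone_interval (dual_cone C) (- (real n *\<^sub>R f)) (real n *\<^sub>R f)"
      by blast
    then have "g + real n *\<^sub>R f \<in> dual_cone C"
      by (simp add: cone_interval_def cone_le_def)
    moreover have "real n *\<^sub>R f \<in> dual_cone C"
      using mem_dual_cone_if_coercive[OF f] by (auto intro: convex_cone_scaleR[OF convex_cone_dual_cone])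
    moreover have "g = (g + real n *\<^sub>R f) - real n *\<^sub>R f" by simp
    ultimately show ?thesis by blast
  qed
  then show ?thesis by blast
qed

text \<open>
  Unit vectors of \<open>C\<close> stay outside a weak neighbourhood of \<open>0\<close>, so one of finitely many functionals is at
  least \<open>e\<close> on each of them in absolute value. Density replaces these functionals by elements of the
  dual cone, where a sum dominates each of its terms.
\<close>

lemma coercive_if_point_of_continuity:
  fixes C :: "'a::real_normed_vector set"
  assumes C: "convex_cone C" and cont: "point_of_continuity C 0"
    and dense: "closure {f - g |f g. f \<in> dual_cone C \<and> g \<in> dual_cone C} = UNIV"
  shows "\<exists>f. coercive_on C f"
proof -
  have ball: "openin (top_of_set C) (ball 0 1 \<inter> C)" "0 \<in> ball 0 1 \<inter> C"
    using convex_cone_contains_0[OF C] by (auto simp: openin_open)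
  then obtain U where U: "openin (subtopology weak_topology C) U" "0 \<in> U" "\<forall>y\<in>U. y \<in> ball 0 1 \<inter> C"
    using cont[unfolded point_of_continuity_def topcontinuous_at_def, THEN conjunct2, THEN conjunct2,
        THEN conjunct2, rule_format, OF conjI, OF ball] by blast
  then obtain W where W: "openin weak_topology W" "U = W \<inter> C"
    by (auto simp: openin_subtopology)
  obtain F :: "('a \<Rightarrow>\<^sub>L real) set" and e where F: "finite F" "0 < e" and
    sub: "{y. \<forall>f\<in>F. \<bar>blinfun_apply f (y - 0)\<bar> < e} \<subseteq> W"
    using weak_neighbourhood_basis[OF W(1), of 0] U(2) W(2) by blast
  have "\<exists>p q. p \<in> dual_cone C \<and> q \<in> dual_cone C \<and> norm (p - q - f) < e / 2" for f
  proof -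
    have "f \<in> closure {f - g |f g. f \<in> dual_cone C \<and> g \<in> dual_cone C}"
      using dense by simp
    then obtain d where "d \<in> {f - g |f g. f \<in> dual_cone C \<and> g \<in> dual_cone C}" "dist d f < e / 2"
      using F(2) unfolding closure_approachable by (meson half_gt_zero)
    then show ?thesis by (auto simp: dist_norm)
  qed
  then obtain p q where
    pq: "\<And>f. p f \<in> dual_cone C" "\<And>f. q f \<in> dual_cone C" "\<And>f. norm (p f - q f - f) < e / 2"
    by metis
  define g where "g = (\<Sum>f\<in>F. p f + q f)"
  have "coercive_on C g"
  proof (rule coercive_on_if_sphere[OF C, of "e / 2"])
    show "0 < e / 2" using F by simp
  next
    fix c assume c: "c \<in> C" "norm c = 1"
    have pos: "0 \<le> blinfun_apply (p f) c" "0 \<le> blinfun_apply (q f) c" for f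
      using pq c(1) by (auto simp: dual_cone_def)
    have "c \<notin> W"
    proof
      assume "c \<in> W"
      then have "c \<in> ball 0 1" using U(3) W(2) c(1) by blast
      then show False using c(2) by simp
    qed
    then have "\<not> (\<forall>f\<in>F. \<bar>blinfun_apply f c\<bar> < e)"
      using sub by auto
    then obtain f where f: "f \<in> F" "e \<le> \<bar>blinfun_apply f c\<bar>"
      by (meson not_less)
    \<comment> \<open>Norm approximation controls values only on bounded sets, hence the restriction to unit vectors.\<close>
    have "\<bar>blinfun_apply (p f - q f - f) c\<bar> \<le> e / 2"
      using norm_blinfun[of "p f - q f - f" c] pq(3)[of f] c(2) by simp
    then have "e / 2 \<le> \<bar>blinfun_apply (p f) c - blinfun_apply (q f) c\<bar>"
      using f(2) unfolding blinfun.diff_left by linarith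
    also have "\<dots> \<le> blinfun_apply (p f + q f) c"
      using pos[of f] by (simp add: blinfun.add_left)
    also have "\<dots> \<le> blinfun_apply g c"
      unfolding g_def blinfun.sum_left using F(1) f(1) pos
      by (intro member_le_sum) (auto simp: blinfun.add_left)
    finally show "e / 2 \<le> blinfun_apply g c" .
  qed
  then show ?thesis ..
qed

theorem theorem2:
  fixes C :: "'a::real_normed_vector set"
  assumes "convex_cone C" and "pointed C"
  shows
    "(denting_point C 0 \<longleftrightarrow>
        (\<exists>(n::nat) (f :: nat \<Rightarrow> 'a \<Rightarrow>\<^sub>L real) (l :: nat \<Rightarrow> real).
           1 \<le> n \<and> (\<forall>i\<in>{1..n}. f i \<in> dual_cone C \<and> 0 < l i) \<and>
           bounded ((\<Inter>i\<in>{1..n}. {x. blinfun_apply (f i) x < l i}) \<inter> C)))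
     \<and>
     (denting_point C 0 \<longleftrightarrow>
        point_of_continuity C 0 \<and>
        closure {f - g |f g. f \<in> dual_cone C \<and> g \<in> dual_cone C} = UNIV)
     \<and>
     (denting_point C 0 \<longleftrightarrow> (\<exists>k. order_unit (dual_cone C) k))
     \<and>
     (denting_point C 0 \<longleftrightarrow>
        (\<exists>f :: nat \<Rightarrow> 'a \<Rightarrow>\<^sub>L real.
           (\<forall>n\<ge>1. f n \<in> dual_cone C) \<and>
           (\<Union>n\<in>{1..}. cone_interval (dual_cone C) (- (real n *\<^sub>R f n)) (real n *\<^sub>R f n)) = UNIV))"
    (is "(_ \<longleftrightarrow> ?slice) \<and> (_ \<longleftrightarrow> ?cont) \<and> (_ \<longleftrightarrow> ?unit) \<and> (_ \<longleftrightarrow> ?seq)")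
proof -
  note C = assms(1)
  have "denting_point C 0 \<longleftrightarrow> (\<exists>f. coercive_on C f)"
    using denting_point_if_coercive[OF C] coercive_if_denting_point[OF C] by blast
  moreover have "?slice \<longleftrightarrow> (\<exists>f. coercive_on C f)"
    by (rule coercive_iff_bounded_slice[OF C, symmetric])
  moreover have "?cont \<longleftrightarrow> (\<exists>f. coercive_on C f)"
  proof
    show "?cont \<Longrightarrow> \<exists>f. coercive_on C f"
      using coercive_if_point_of_continuity[OF C] by blast
    show "\<exists>f. coercive_on C f \<Longrightarrow> ?cont"
      using point_of_continuity_if_coercive[OF C]
      by (elim exE) (simp only: dual_cone_differences_if_coercive closure_UNIV simp_thms)
  qed
  moreover have "(\<exists>f. coercive_on C f) \<Longrightarrow> ?unit"
    using order_unit_if_coercive by blast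
  moreover have "?unit \<Longrightarrow> ?seq"
    unfolding order_unit_def by (elim exE, rule exI[of _ "\<lambda>_. k" for k]) blast
  moreover have "?seq \<Longrightarrow> \<exists>f. coercive_on C f"
    using coercive_if_countable_cone_interval_cover[OF C] by blast
  ultimately show ?thesis by argo
qed

end
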